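(* Let $R$ be a semiring, $M\neq\{0\}$ a bipotent semiring and $v:R\to M$ a surjective $m$-valuation. Let $\mathfrak p:=\mathfrak p_v=\{x\in R\mid v(x)<1\}$ (a prime of $R$), and let $w:=v_{R,\mathfrak p}:R\to N:=M(R,\mathfrak p)$ be the $V^0$-valuation associated to $\mathfrak p$. Then $v$ dominates $w$, i.e., there exists a unique semiring homomorphism $\gamma:M\twoheadrightarrow N$ (it is surjective) such that $w=\gamma\circ v$.
   Context: All semirings are commutative with $0$ and $1$. A bipotent semiring is a semiring $M$ equipped with a total ordering such that $(M,\cdot)$ is a totally ordered monoid (the order is compatible with multiplication), $0$ is the smallest element (and is absorbing), and $x+y=\max(x,y)$. An $m$-valuation on a semiring $R$ is a map $v:R\to M$ to a bipotent semiring with $v(0)=0$, $v(1)=1$, $v(xy)=v(x)v(y)$ and $v(x+y)\le v(x)+v(y)=\max(v(x),v(y))$. A prime of $R$ is a subset $\mathfrak p\subset R$ with $0\in\mathfrak p$, $1\notin\mathfrak p$, $\mathfrak p+\mathfrak p\subset\mathfrak p$, and both $\mathfrak p$ and $R\setminus\mathfrak p$ closed under multiplication. For $x\in R$ put $[\mathfrak p:x]=\{z\in R\mid zx\in\mathfrak p\}$, and $x\sim y$ iff $[\mathfrak p:x]=[\mathfrak p:y]$. This is a multiplicative equivalence relation. $M(R,\mathfrak p):=R/\!\sim$, with multiplication $[x][y]=[xy]$, total ordering $[y]\le[x]\iff[\mathfrak p:x]\subset[\mathfrak p:y]$, and addition given by the maximum, is a bipotent semiring. $v_{R,\mathfrak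 p}:R\to M(R,\mathfrak p)$, $x\mapsto[x]$, is an $m$-valuation, called the $V^0$-valuation associated to $\mathfrak p$. *)

theory Defs
  imports "HOL-Algebra.Ring"
begin

text \<open>
  All structures are carrier based, since \<open>M(R, \<pp>)\<close> depends on the value \<open>\<pp>\<close>. As everywhere
  in HOL-Algebra, \<open>\<zero> \<noteq> \<one>\<close> is not assumed.
\<close>

locale comm_semiring = semiring R + comm_monoid R for R (structure)

record 'a ordered_ring_rec = "'a ring" +
  ord_rel :: "('a \<times> 'a) set"

abbreviation ord_le :: "('a, 'm) ordered_ring_rec_scheme \<Rightarrow> 'a \<Rightarrow> 'a \<Rightarrow> bool"
    (\<open>(_/ \<preceq>\<index> _)\<close> [51, 51] 50)
  where "x \<preceq>\<^bsub>M\<^esub> y \<equiv> (x, y) \<in> ord_rel M"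

locale bipotent_semiring = comm_semiring M for M (structure) +
  assumes ord_linear: "linear_order_on (carrier M) (ord_rel M)"
    and ord_mult_mono:
      "\<lbrakk> x \<in> carrier M; y \<in> carrier M; z \<in> carrier M; x \<preceq> y \<rbrakk> \<Longrightarrow> x \<otimes> z \<preceq> y \<otimes> z"
    and ord_zero_least: "x \<in> carrier M \<Longrightarrow> \<zero> \<preceq> x"
    and add_eq_max:
      "\<lbrakk> x \<in> carrier M; y \<in> carrier M \<rbrakk> \<Longrightarrow> x \<oplus> y = (if x \<preceq> y then y else x)"

text \<open>Ring homomorphisms of HOL-Algebra need not preserve \<open>\<zero>\<close> when the target is only a semiring.\<close>

definition semiring_hom ::
    "('a, 'm) ring_scheme \<Rightarrow> ('b, 'n) ring_scheme \<Rightarrow> ('a \<Rightarrow> 'b) set" where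
  "semiring_hom A B = {h \<in> ring_hom A B. h \<zero>\<^bsub>A\<^esub> = \<zero>\<^bsub>B\<^esub>}"

definition m_valuation ::
    "('a, 'm) ring_scheme \<Rightarrow> ('b, 'n) ordered_ring_rec_scheme \<Rightarrow> ('a \<Rightarrow> 'b) \<Rightarrow> bool" where
  "m_valuation R M v \<longleftrightarrow>
     v \<in> carrier R \<rightarrow> carrier M \<and>
     v \<zero>\<^bsub>R\<^esub> = \<zero>\<^bsub>M\<^esub> \<and>
     v \<one>\<^bsub>R\<^esub> = \<one>\<^bsub>M\<^esub> \<and>
     (\<forall>x\<in>carrier R. \<forall>y\<in>carrier R. v (x \<otimes>\<^bsub>R\<^esub> y) = v x \<otimes>\<^bsub>M\<^esub> v y) \<and>
     (\<forall>x\<in>carrier R. \<forall>y\<in>carrier R. v (x \<oplus>\<^bsub>R\<^esub> y) \<preceq>\<^bsub>M\<^esub> v x \<oplus>\<^bsub>M\<^esub> v y)"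

definition semiring_prime :: "('a, 'm) ring_scheme \<Rightarrow> 'a set \<Rightarrow> bool" where
  "semiring_prime R \<pp> \<longleftrightarrow>
     \<pp> \<subseteq> carrier R \<and>
     \<zero>\<^bsub>R\<^esub> \<in> \<pp> \<and>
     \<one>\<^bsub>R\<^esub> \<notin> \<pp> \<and>
     (\<forall>x\<in>\<pp>. \<forall>y\<in>\<pp>. x \<oplus>\<^bsub>R\<^esub> y \<in> \<pp>) \<and>
     (\<forall>x\<in>\<pp>. \<forall>y\<in>\<pp>. x \<otimes>\<^bsub>R\<^esub> y \<in> \<pp>) \<and>
     (\<forall>x\<in>carrier R - \<pp>. \<forall>y\<in>carrier R - \<pp>. x \<otimes>\<^bsub>R\<^esub> y \<in> carrier R - \<pp>)"

definition prime_quot :: "('a, 'm) ring_scheme \<Rightarrow> 'a set \<Rightarrow> 'a \<Rightarrow> 'a set" where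
  "prime_quot R \<pp> x = {z \<in> carrier R. z \<otimes>\<^bsub>R\<^esub> x \<in> \<pp>}"

definition prime_rel :: "('a, 'm) ring_scheme \<Rightarrow> 'a set \<Rightarrow> ('a \<times> 'a) set" where
  "prime_rel R \<pp> =
     {(x, y). x \<in> carrier R \<and> y \<in> carrier R \<and> prime_quot R \<pp> x = prime_quot R \<pp> y}"

definition V0_valuation :: "('a, 'm) ring_scheme \<Rightarrow> 'a set \<Rightarrow> 'a \<Rightarrow> 'a set" where
  "V0_valuation R \<pp> x = prime_rel R \<pp> `` {x}"

definition V0_ord :: "('a, 'm) ring_scheme \<Rightarrow> 'a set \<Rightarrow> ('a set \<times> 'a set) set" where
  "V0_ord R \<pp> =
     {(V0_valuation R \<pp> y, V0_valuation R \<pp> x) | x y.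
        x \<in> carrier R \<and> y \<in> carrier R \<and> prime_quot R \<pp> x \<subseteq> prime_quot R \<pp> y}"

text \<open>
  The product of two classes is the union of the classes of all products of representatives;
  this union is a single class by \<open>V0_mult_class\<close> below.
\<close>

definition V0_semiring :: "('a, 'm) ring_scheme \<Rightarrow> 'a set \<Rightarrow> 'a set ordered_ring_rec" where
  "V0_semiring R \<pp> =
     \<lparr> carrier = carrier R // prime_rel R \<pp>,
       mult = (\<lambda>A B. \<Union>x\<in>A. \<Union>y\<in>B. V0_valuation R \<pp> (x \<otimes>\<^bsub>R\<^esub> y)),
       one = V0_valuation R \<pp> \<one>\<^bsub>R\<^esub>,
       zero = V0_valuation R \<pp> \<zero>\<^bsub>R\<^esub>,
       add = (\<lambda>A B. if (A, B) \<in> V0_ord R \<pp> then B else A),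
       ord_rel = V0_ord R \<pp> \<rparr>"

definition valuation_prime ::
    "('a, 'm) ring_scheme \<Rightarrow> ('b, 'n) ordered_ring_rec_scheme \<Rightarrow> ('a \<Rightarrow> 'b) \<Rightarrow> 'a set" where
  "valuation_prime R M v = {x \<in> carrier R. v x \<preceq>\<^bsub>M\<^esub> \<one>\<^bsub>M\<^esub> \<and> v x \<noteq> \<one>\<^bsub>M\<^esub>}"

lemma equiv_prime_rel: "equiv (carrier R) (prime_rel R \<pp>)"
  by (auto simp: equiv_def refl_on_def sym_def trans_def prime_rel_def)

lemma V0_eq_iff:
  assumes "x \<in> carrier R" "y \<in> carrier R"
  shows "V0_valuation R \<pp> x = V0_valuation R \<pp> y \<longleftrightarrow> prime_quot R \<pp> x = prime_quot R \<pp> y"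
  unfolding V0_valuation_def using assms
  by (subst eq_equiv_class_iff[OF equiv_prime_rel]) (auto simp: prime_rel_def)

lemma V0_ord_iff:
  assumes "x \<in> carrier R" "y \<in> carrier R"
  shows "(V0_valuation R \<pp> y, V0_valuation R \<pp> x) \<in> V0_ord R \<pp>
    \<longleftrightarrow> prime_quot R \<pp> x \<subseteq> prime_quot R \<pp> y"
proof
  assume "(V0_valuation R \<pp> y, V0_valuation R \<pp> x) \<in> V0_ord R \<pp>"
  then obtain x' y' where "x' \<in> carrier R" "y' \<in> carrier R"
      and sub: "prime_quot R \<pp> x' \<subseteq> prime_quot R \<pp> y'"
      and eq: "V0_valuation R \<pp> y = V0_valuation R \<pp> y'"
        "V0_valuation R \<pp> x = V0_valuation R \<pp> x'"
    unfolding V0_ord_def by blast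
  then show "prime_quot R \<pp> x \<subseteq> prime_quot R \<pp> y"
    using assms by (metis V0_eq_iff)
next
  assume "prime_quot R \<pp> x \<subseteq> prime_quot R \<pp> y"
  then show "(V0_valuation R \<pp> y, V0_valuation R \<pp> x) \<in> V0_ord R \<pp>"
    unfolding V0_ord_def using assms by blast
qed

lemma V0_carrier: "carrier (V0_semiring R \<pp>) = V0_valuation R \<pp> ` carrier R"
  by (auto simp: V0_semiring_def quotient_def V0_valuation_def)

context comm_semiring
begin

lemma prime_quot_mult:
  assumes "x \<in> carrier R" "y \<in> carrier R"
  shows "prime_quot R \<pp> (x \<otimes> y) = {z \<in> carrier R. z \<otimes> y \<in> prime_quot R \<pp> x}"
  using assms by (auto simp: prime_quot_def m_ac)

lemma prime_quot_mult_mono: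
  assumes "x \<in> carrier R" "y \<in> carrier R" "z \<in> carrier R"
    "prime_quot R \<pp> x \<subseteq> prime_quot R \<pp> y"
  shows "prime_quot R \<pp> (x \<otimes> z) \<subseteq> prime_quot R \<pp> (y \<otimes> z)"
  using assms by (auto simp: prime_quot_mult)

lemma V0_mult_class:
  assumes "x \<in> carrier R" "y \<in> carrier R"
  shows "V0_valuation R \<pp> x \<otimes>\<^bsub>V0_semiring R \<pp>\<^esub> V0_valuation R \<pp> y = V0_valuation R \<pp> (x \<otimes> y)"
proof -
  have eq: "V0_valuation R \<pp> (x' \<otimes> y') = V0_valuation R \<pp> (x \<otimes> y)"
    if x': "x' \<in> V0_valuation R \<pp> x" and y': "y' \<in> V0_valuation R \<pp> y" for x' y'
  proof -
    have c: "x' \<in> carrier R" "y' \<in> carrier R"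
      and q: "prime_quot R \<pp> x = prime_quot R \<pp> x'" "prime_quot R \<pp> y = prime_quot R \<pp> y'"
      using x' y' by (auto simp: V0_valuation_def prime_rel_def)
    have "prime_quot R \<pp> (x' \<otimes> y') = prime_quot R \<pp> (x \<otimes> y')"
      using assms c q by (simp add: prime_quot_mult)
    also have "\<dots> = prime_quot R \<pp> (y' \<otimes> x)"
      using assms c by (simp add: m_comm)
    also have "\<dots> = prime_quot R \<pp> (y \<otimes> x)"
      using assms c q by (simp add: prime_quot_mult)
    also have "\<dots> = prime_quot R \<pp> (x \<otimes> y)"
      using assms by (simp add: m_comm)
    finally show ?thesis
      using assms c by (simp add: V0_eq_iff)
  qed
  have "x \<in> V0_valuation R \<pp> x" "y \<in> V0_valuation R \<pp> y"
    using assms by (auto simp: V0_valuation_def prime_rel_def)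
  with eq have "(\<Union>x'\<in>V0_valuation R \<pp> x. \<Union>y'\<in>V0_valuation R \<pp> y. V0_valuation R \<pp> (x' \<otimes> y'))
      = V0_valuation R \<pp> (x \<otimes> y)"
    by blast
  then show ?thesis
    by (simp add: V0_semiring_def)
qed

lemma prime_quot_total:
  assumes p: "semiring_prime R \<pp>" and c: "x \<in> carrier R" "y \<in> carrier R"
  shows "prime_quot R \<pp> x \<subseteq> prime_quot R \<pp> y \<or> prime_quot R \<pp> y \<subseteq> prime_quot R \<pp> x"
proof (rule ccontr)
  assume "\<not> ?thesis"
  then obtain z u where zu: "z \<in> carrier R" "u \<in> carrier R"
      "z \<otimes> x \<in> \<pp>" "z \<otimes> y \<notin> \<pp>" "u \<otimes> y \<in> \<pp>" "u \<otimes> x \<notin> \<pp>"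
    by (auto simp: prime_quot_def)
  have "(z \<otimes> x) \<otimes> (u \<otimes> y) \<in> \<pp>"
    using p zu unfolding semiring_prime_def by simp
  moreover have "(z \<otimes> y) \<otimes> (u \<otimes> x) \<notin> \<pp>"
    using p zu c unfolding semiring_prime_def by simp
  moreover have "(z \<otimes> x) \<otimes> (u \<otimes> y) = (z \<otimes> y) \<otimes> (u \<otimes> x)"
    using zu c by (simp add: m_ac)
  ultimately show False by simp
qed

lemma bipotent_V0_semiring:
  assumes p: "semiring_prime R \<pp>"
  shows "bipotent_semiring (V0_semiring R \<pp>)"
proof -
  let ?N = "V0_semiring R \<pp>" and ?w = "V0_valuation R \<pp>" and ?q = "prime_quot R \<pp>"
  note [simp] = V0_carrier V0_mult_class V0_ord_iff V0_eq_iff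
  have ordN [simp]: "ord_rel ?N = V0_ord R \<pp>"
    and oneN [simp]: "\<one>\<^bsub>?N\<^esub> = ?w \<one>" and zeroN [simp]: "\<zero>\<^bsub>?N\<^esub> = ?w \<zero>"
    by (simp_all add: V0_semiring_def)
  have addN: "?w x \<oplus>\<^bsub>?N\<^esub> ?w y = ?w (if ?q y \<subseteq> ?q x then y else x)"
    if "x \<in> carrier R" "y \<in> carrier R" for x y
    using that by (simp add: V0_semiring_def)
  have tot: "?q x \<subseteq> ?q y \<or> ?q y \<subseteq> ?q x" if "x \<in> carrier R" "y \<in> carrier R" for x y
    using prime_quot_total[OF p that] .
  have q0: "?q \<zero> = carrier R"
    using p by (auto simp: prime_quot_def semiring_prime_def)
  have qle: "?q x \<subseteq> carrier R" for x
    by (auto simp: prime_quot_def)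
  have mono: "?q (x \<otimes> z) \<subseteq> ?q (y \<otimes> z)"
    if "x \<in> carrier R" "y \<in> carrier R" "z \<in> carrier R" "?q x \<subseteq> ?q y" for x y z
    using prime_quot_mult_mono[OF that] .
  have distr: "(a \<oplus>\<^bsub>?N\<^esub> b) \<otimes>\<^bsub>?N\<^esub> c = a \<otimes>\<^bsub>?N\<^esub> c \<oplus>\<^bsub>?N\<^esub> b \<otimes>\<^bsub>?N\<^esub> c"
    if abc: "a \<in> carrier ?N" "b \<in> carrier ?N" "c \<in> carrier ?N" for a b c
  proof -
    obtain x y z where xyz: "x \<in> carrier R" "y \<in> carrier R" "z \<in> carrier R"
        "a = ?w x" "b = ?w y" "c = ?w z"
      using abc by auto
    show ?thesis
    proof (cases "?q y \<subseteq> ?q x")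
      case True
      with mono[of y x z] xyz show ?thesis by (simp add: addN)
    next
      case False
      with tot[of x y] have "?q x \<subseteq> ?q y" using xyz by blast
      with False mono[of x y z] xyz show ?thesis by (auto simp: addN)
    qed
  qed
  have comm: "a \<otimes>\<^bsub>?N\<^esub> b = b \<otimes>\<^bsub>?N\<^esub> a" if "a \<in> carrier ?N" "b \<in> carrier ?N" for a b
    using that by (auto simp: m_comm)
  have cl: "a \<oplus>\<^bsub>?N\<^esub> b \<in> carrier ?N" "a \<otimes>\<^bsub>?N\<^esub> b \<in> carrier ?N"
    if "a \<in> carrier ?N" "b \<in> carrier ?N" for a b
    using that by (auto simp: addN)
  have mon: "comm_monoid ?N"
    by (rule comm_monoidI) (auto simp: m_ac)
  have addmon: "abelian_monoid ?N"
  proof (rule abelian_monoidI)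
    fix a b c assume "a \<in> carrier ?N" "b \<in> carrier ?N" "c \<in> carrier ?N"
    then obtain x y z where "x \<in> carrier R" "y \<in> carrier R" "z \<in> carrier R"
        "a = ?w x" "b = ?w y" "c = ?w z"
      by auto
    then show "(a \<oplus>\<^bsub>?N\<^esub> b) \<oplus>\<^bsub>?N\<^esub> c = a \<oplus>\<^bsub>?N\<^esub> (b \<oplus>\<^bsub>?N\<^esub> c)"
      using tot[of x y] tot[of y z] tot[of x z] by (auto simp: addN)
  next
    fix a b assume "a \<in> carrier ?N" "b \<in> carrier ?N"
    then obtain x y where "x \<in> carrier R" "y \<in> carrier R" "a = ?w x" "b = ?w y"
      by auto
    then show "a \<oplus>\<^bsub>?N\<^esub> b = b \<oplus>\<^bsub>?N\<^esub> a"
      using tot[of x y] by (auto simp: addN)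
  qed (use cl qle q0 in \<open>auto simp: addN\<close>)
  have semi: "semiring ?N"
  proof (intro semiring.intro semiring_axioms.intro addmon)
    show "monoid ?N" using mon by (rule comm_monoid.axioms)
  next
    fix a b c assume "a \<in> carrier ?N" "b \<in> carrier ?N" "c \<in> carrier ?N"
    then show "c \<otimes>\<^bsub>?N\<^esub> (a \<oplus>\<^bsub>?N\<^esub> b) = c \<otimes>\<^bsub>?N\<^esub> a \<oplus>\<^bsub>?N\<^esub> c \<otimes>\<^bsub>?N\<^esub> b"
      using distr[of a b c] comm cl by metis
  qed (use distr in auto)
  have lin: "linear_order_on (carrier ?N) (ord_rel ?N)"
    unfolding linear_order_on_def partial_order_on_def preorder_on_def
  proof (intro conjI)
    show "ord_rel ?N \<subseteq> carrier ?N \<times> carrier ?N"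
      unfolding ordN V0_ord_def V0_carrier by blast
    show "refl_on (carrier ?N) (ord_rel ?N)"
      by (auto simp: refl_on_def)
    show "trans (ord_rel ?N)"
    proof (rule transI)
      fix a b c assume ab: "(a, b) \<in> ord_rel ?N" and bc: "(b, c) \<in> ord_rel ?N"
      obtain x y where "a = ?w x" "b = ?w y" "x \<in> carrier R" "y \<in> carrier R"
        using ab unfolding ordN V0_ord_def by blast
      moreover obtain z where "c = ?w z" "z \<in> carrier R"
        using bc unfolding ordN V0_ord_def by blast
      ultimately show "(a, c) \<in> ord_rel ?N"
        using ab bc by auto
    qed
    show "antisym (ord_rel ?N)"
    proof (rule antisymI)
      fix a b assume ab: "(a, b) \<in> ord_rel ?N" and ba: "(b, a) \<in> ord_rel ?N"
      obtain x y where "a = ?w x" "b = ?w y" "x \<in> carrier R" "y \<in> carrier R"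
        using ab unfolding ordN V0_ord_def by blast
      then show "a = b"
        using ab ba by auto
    qed
    show "total_on (carrier ?N) (ord_rel ?N)"
      using tot by (auto simp: total_on_def)
  qed
  show ?thesis
  proof (intro bipotent_semiring.intro comm_semiring.intro bipotent_semiring_axioms.intro
      semi mon lin)
    fix a b assume "a \<in> carrier ?N" "b \<in> carrier ?N"
    then show "a \<oplus>\<^bsub>?N\<^esub> b = (if (a, b) \<in> ord_rel ?N then b else a)"
      by (simp add: V0_semiring_def)
  qed (use mono qle q0 in auto)
qed

lemma m_valuation_V0:
  assumes p: "semiring_prime R \<pp>"
  shows "m_valuation R (V0_semiring R \<pp>) (V0_valuation R \<pp>)"
proof -
  let ?N = "V0_semiring R \<pp>" and ?w = "V0_valuation R \<pp>" and ?q = "prime_quot R \<pp>"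
  have "(?w (x \<oplus> y), ?w x \<oplus>\<^bsub>?N\<^esub> ?w y) \<in> ord_rel ?N"
    if c: "x \<in> carrier R" "y \<in> carrier R" for x y
  proof -
    have add: "?w x \<oplus>\<^bsub>?N\<^esub> ?w y = ?w (if ?q y \<subseteq> ?q x then y else x)"
      using c by (simp add: V0_semiring_def V0_ord_iff)
    have "?q x \<inter> ?q y \<subseteq> ?q (x \<oplus> y)"
      using p c by (auto simp: prime_quot_def semiring_prime_def r_distr)
    then have "?q (if ?q y \<subseteq> ?q x then y else x) \<subseteq> ?q (x \<oplus> y)"
      using prime_quot_total[OF p c] by auto
    then show ?thesis
      unfolding add using c by (simp add: V0_semiring_def V0_ord_iff)
  qed
  then show ?thesis
    by (auto simp: m_valuation_def V0_carrier V0_mult_class) (simp_all add: V0_semiring_def)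
qed

end

end

theory Submission
  imports Defs
begin

text \<open>
  By totality \<open>\<pp>\<close> consists of the \<open>x\<close> for which \<open>1 \<le> v x\<close> fails, so \<open>z \<in> [\<pp> : x]\<close> depends on \<open>v x\<close>
  only through whether \<open>1 \<le> v z v x\<close>. Hence \<open>v x \<le> v y\<close> implies \<open>[\<pp> : y] \<subseteq> [\<pp> : x]\<close>, that is
  \<open>w x \<le> w y\<close>. So \<open>w\<close> factors through a monotone multiplicative map \<open>\<gamma>\<close>, and between
  bipotent semirings such a map is additive.
\<close>

context bipotent_semiring
begin

lemma ord_refl: "x \<in> carrier M \<Longrightarrow> x \<preceq> x"
  using ord_linear
  by (simp add: linear_order_on_def partial_order_on_def preorder_on_def refl_on_def)

lemma ord_trans: "x \<preceq> y \<Longrightarrow> y \<preceq> z \<Longrightarrow> x \<preceq> z"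
  using ord_linear transD
  by (metis linear_order_on_def partial_order_on_def preorder_on_def)

lemma ord_antisym: "x \<preceq> y \<Longrightarrow> y \<preceq> x \<Longrightarrow> x = y"
  using ord_linear antisymD
  by (metis linear_order_on_def partial_order_on_def)

lemma ord_total: "x \<in> carrier M \<Longrightarrow> y \<in> carrier M \<Longrightarrow> x \<preceq> y \<or> y \<preceq> x"
  using ord_linear ord_refl
  by (cases "x = y") (auto simp: linear_order_on_def total_on_def)

text \<open>If \<open>\<one> = \<zero>\<close>, every \<open>x\<close> equals
  \<open>\<one> \<otimes> x = \<zero> \<otimes> x = \<zero>\<close>. This turns nontriviality of the
  carrier into the form that puts 0 into the prime of a valuation.\<close>

lemma one_neq_zero:
  assumes "carrier M \<noteq> {\<zero>}"
  shows "\<one> \<noteq> \<zero>"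
proof
  assume "\<one> = \<zero>"
  then have "x = \<zero>" if "x \<in> carrier M" for x
    using that l_one l_null by metis
  with assms show False
    by blast
qed

end

text \<open>The sum of two elements is the larger of them, and a monotone map carries the larger to
  the larger.\<close>

lemma mono_mult_hom_in_semiring_hom:
  assumes "bipotent_semiring M" "bipotent_semiring N"
    and closed: "\<gamma> \<in> carrier M \<rightarrow> carrier N"
    and zero: "\<gamma> \<zero>\<^bsub>M\<^esub> = \<zero>\<^bsub>N\<^esub>" and one: "\<gamma> \<one>\<^bsub>M\<^esub> = \<one>\<^bsub>N\<^esub>"
    and mult: "\<And>a b. \<lbrakk>a \<in> carrier M; b \<in> carrier M\<rbrakk> \<Longrightarrow> \<gamma> (a \<otimes>\<^bsub>M\<^esub> b) = \<gamma> a \<otimes>\<^bsub>N\<^esub> \<gamma> b"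
    and mono: "\<And>a b. \<lbrakk>a \<in> carrier M; b \<in> carrier M; a \<preceq>\<^bsub>M\<^esub> b\<rbrakk> \<Longrightarrow> \<gamma> a \<preceq>\<^bsub>N\<^esub> \<gamma> b"
  shows "\<gamma> \<in> semiring_hom M N"
proof -
  interpret M: bipotent_semiring M by fact
  interpret N: bipotent_semiring N by fact
  have "\<gamma> (a \<oplus>\<^bsub>M\<^esub> b) = \<gamma> a \<oplus>\<^bsub>N\<^esub> \<gamma> b" if c: "a \<in> carrier M" "b \<in> carrier M" for a b
  proof -
    have "\<gamma> a \<in> carrier N" "\<gamma> b \<in> carrier N"
      using c closed by auto
    \<comment> \<open>\<gamma> may identify distinct elements: if \<open>b\<close> is strictly below
      \<open>a\<close> but \<gamma> a \<le> \<gamma> b also holds, addition in \<open>N\<close>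
      selects \<gamma> b while \<gamma> (a + b) is \<gamma> a. Antisymmetry of \<open>N\<close>
      makes the two equal.\<close>
    then show ?thesis
      using c mono[of a b] mono[of b a] M.ord_total[of a b] N.ord_antisym[of "\<gamma> a" "\<gamma> b"]
      by (auto simp: M.add_eq_max N.add_eq_max)
  qed
  then show ?thesis
    using closed zero one mult by (auto simp: semiring_hom_def ring_hom_def)
qed

locale bipotent_valuation = R: comm_semiring R + M: bipotent_semiring M
  for R :: "('a, 'm) ring_scheme" and M :: "('b, 'n) ordered_ring_rec_scheme" +
  fixes v :: "'a \<Rightarrow> 'b"
  assumes valuation: "m_valuation R M v"
begin

lemma v_closed: "x \<in> carrier R \<Longrightarrow> v x \<in> carrier M"
  and v_zero: "v \<zero>\<^bsub>R\<^esub> = \<zero>\<^bsub>M\<^esub>"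
  and v_one: "v \<one>\<^bsub>R\<^esub> = \<one>\<^bsub>M\<^esub>"
  and v_mult: "\<lbrakk>x \<in> carrier R; y \<in> carrier R\<rbrakk> \<Longrightarrow> v (x \<otimes>\<^bsub>R\<^esub> y) = v x \<otimes>\<^bsub>M\<^esub> v y"
  and v_add: "\<lbrakk>x \<in> carrier R; y \<in> carrier R\<rbrakk> \<Longrightarrow> v (x \<oplus>\<^bsub>R\<^esub> y) \<preceq>\<^bsub>M\<^esub> v x \<oplus>\<^bsub>M\<^esub> v y"
  using valuation by (auto simp: m_valuation_def)

text \<open>Totality and antisymmetry turn the strict inequality v x < 1 into a negated weak one, so
  that closure properties reduce to transitivity.\<close>

lemma mem_valuation_prime_iff:
  "x \<in> valuation_prime R M v \<longleftrightarrow> x \<in> carrier R \<and> \<not> \<one>\<^bsub>M\<^esub> \<preceq>\<^bsub>M\<^esub> v x"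
  using M.ord_total[of "\<one>\<^bsub>M\<^esub>" "v x"] M.ord_antisym[of "\<one>\<^bsub>M\<^esub>" "v x"]
    M.ord_refl[of "\<one>\<^bsub>M\<^esub>"] v_closed[of x]
  by (auto simp: valuation_prime_def)

lemma semiring_prime_valuation_prime:
  assumes "carrier M \<noteq> {\<zero>\<^bsub>M\<^esub>}"
  shows "semiring_prime R (valuation_prime R M v)"
proof -
  have zero: "\<not> \<one>\<^bsub>M\<^esub> \<preceq>\<^bsub>M\<^esub> \<zero>\<^bsub>M\<^esub>"
    using M.one_neq_zero[OF assms] M.ord_antisym[OF _ M.ord_zero_least] by blast
  \<comment> \<open>The bound on v (x + y) is v x or v y itself, so 1 \<le> v (x + y) would put 1
    below one of these two.\<close>
  have add: "\<not> \<one>\<^bsub>M\<^esub> \<preceq>\<^bsub>M\<^esub> v (x \<oplus>\<^bsub>R\<^esub> y)"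
    if "x \<in> carrier R" "y \<in> carrier R" "\<not> \<one>\<^bsub>M\<^esub> \<preceq>\<^bsub>M\<^esub> v x" "\<not> \<one>\<^bsub>M\<^esub> \<preceq>\<^bsub>M\<^esub> v y" for x y
    using that M.ord_trans[OF _ v_add[of x y], of "\<one>\<^bsub>M\<^esub>"] v_closed
    by (auto simp: M.add_eq_max split: if_splits)
  have mult_lt: "\<not> \<one>\<^bsub>M\<^esub> \<preceq>\<^bsub>M\<^esub> v x \<otimes>\<^bsub>M\<^esub> v y"
    if c: "x \<in> carrier R" "y \<in> carrier R" and lt: "\<not> \<one>\<^bsub>M\<^esub> \<preceq>\<^bsub>M\<^esub> v x" "\<not> \<one>\<^bsub>M\<^esub> \<preceq>\<^bsub>M\<^esub> v y" for x y
  proof -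
    \<comment> \<open>Multiplication is only weakly monotone. So only \<open>v x\<close> is replaced
      by 1, giving v x v y \<le> v y, and strictness comes from v y < 1.\<close>
    have "v x \<preceq>\<^bsub>M\<^esub> \<one>\<^bsub>M\<^esub>"
      using M.ord_total[of "v x" "\<one>\<^bsub>M\<^esub>"] c lt v_closed by auto
    then have "v x \<otimes>\<^bsub>M\<^esub> v y \<preceq>\<^bsub>M\<^esub> v y"
      using M.ord_mult_mono[of "v x" "\<one>\<^bsub>M\<^esub>" "v y"] c v_closed by simp
    then show ?thesis
      using lt M.ord_trans by blast
  qed
  \<comment> \<open>Closure of the complement: 1 \<le> v y = 1 v y \<le> v x v y.\<close>
  have mult_ge: "\<one>\<^bsub>M\<^esub> \<preceq>\<^bsub>M\<^esub> v x \<otimes>\<^bsub>M\<^esub> v y"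
    if "x \<in> carrier R" "y \<in> carrier R" "\<one>\<^bsub>M\<^esub> \<preceq>\<^bsub>M\<^esub> v x" "\<one>\<^bsub>M\<^esub> \<preceq>\<^bsub>M\<^esub> v y" for x y
    using that M.ord_mult_mono[of "\<one>\<^bsub>M\<^esub>" "v x" "v y"] v_closed
      M.ord_trans[of "\<one>\<^bsub>M\<^esub>" "v y" "v x \<otimes>\<^bsub>M\<^esub> v y"]
    by auto
  show ?thesis
    unfolding semiring_prime_def
    using zero add mult_lt mult_ge
    by (auto simp: mem_valuation_prime_iff v_zero v_one v_mult M.ord_refl)
qed

lemma prime_quot_antimono:
  assumes "x \<in> carrier R" "y \<in> carrier R" "v x \<preceq>\<^bsub>M\<^esub> v y"
  shows "prime_quot R (valuation_prime R M v) y \<subseteq> prime_quot R (valuation_prime R M v) x"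
proof
  fix z assume z: "z \<in> prime_quot R (valuation_prime R M v) y"
  then have "z \<in> carrier R"
    by (simp add: prime_quot_def)
  \<comment> \<open>\<open>ord_mult_mono\<close> multiplies on the right, whereas
    \<open>prime_quot\<close> has \<open>z\<close> on the left; hence the appeal to
    commutativity.\<close>
  moreover from this have "v z \<otimes>\<^bsub>M\<^esub> v x \<preceq>\<^bsub>M\<^esub> v z \<otimes>\<^bsub>M\<^esub> v y"
    using assms M.ord_mult_mono[of "v x" "v y" "v z"] v_closed by (simp add: M.m_comm)
  ultimately show "z \<in> prime_quot R (valuation_prime R M v) x"
    using z assms M.ord_trans[of "\<one>\<^bsub>M\<^esub>" "v z \<otimes>\<^bsub>M\<^esub> v x" "v z \<otimes>\<^bsub>M\<^esub> v y"]
    by (auto simp: prime_quot_def mem_valuation_prime_iff v_mult)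
qed

lemma V0_valuation_mono:
  assumes "x \<in> carrier R" "y \<in> carrier R" "v x \<preceq>\<^bsub>M\<^esub> v y"
  shows "V0_valuation R (valuation_prime R M v) x
    \<preceq>\<^bsub>V0_semiring R (valuation_prime R M v)\<^esub> V0_valuation R (valuation_prime R M v) y"
  using assms prime_quot_antimono by (simp add: V0_semiring_def V0_ord_iff)

text \<open>Equality of values gives both inequalities, hence both inclusions of quotients. This
  makes the \<gamma> constructed below independent of the chosen preimages.\<close>

lemma V0_valuation_cong:
  assumes "x \<in> carrier R" "y \<in> carrier R" "v x = v y"
  shows "V0_valuation R (valuation_prime R M v) x = V0_valuation R (valuation_prime R M v) y"
  using assms prime_quot_antimono[of x y] prime_quot_antimono[of y x]
  by (simp add: V0_eq_iff M.ord_refl v_closed)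

lemma ex_dominating_hom:
  assumes nontrivial: "carrier M \<noteq> {\<zero>\<^bsub>M\<^esub>}" and surj: "v ` carrier R = carrier M"
  shows "\<exists>\<gamma> \<in> semiring_hom M (V0_semiring R (valuation_prime R M v)).
    \<gamma> \<in> extensional (carrier M)
    \<and> (\<forall>x\<in>carrier R. V0_valuation R (valuation_prime R M v) x = \<gamma> (v x))"
proof -
  let ?N = "V0_semiring R (valuation_prime R M v)"
  let ?w = "V0_valuation R (valuation_prime R M v)"
  \<comment> \<open>\<open>inv_into\<close> picks some preimage under \<open>v\<close>. Restricting
    to \<open>carrier M\<close> makes \<gamma> extensional, the normal form in which uniqueness is
    stated.\<close>
  define \<gamma> where "\<gamma> = (\<lambda>a\<in>carrier M. ?w (inv_into (carrier R) v a))"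
  have \<gamma>_v: "\<gamma> (v x) = ?w x" if "x \<in> carrier R" for x
    using that v_closed V0_valuation_cong[of "inv_into (carrier R) v (v x)" x]
    by (simp add: \<gamma>_def inv_into_into f_inv_into_f)
  \<comment> \<open>With representatives \<open>a = v x\<close>, each property of \<gamma> becomes
    one of \<open>w\<close> through \<open>\<gamma>_v\<close>, and the choice of preimage no longer
    appears.\<close>
  have rep: "\<exists>x\<in>carrier R. a = v x" if "a \<in> carrier M" for a
    using that surj by blast
  have "\<gamma> \<in> semiring_hom M ?N"
  proof (rule mono_mult_hom_in_semiring_hom)
    show "bipotent_semiring ?N"
      using semiring_prime_valuation_prime[OF nontrivial] by (rule R.bipotent_V0_semiring)
    show "\<gamma> \<in> carrier M \<rightarrow> carrier ?N"
      using rep \<gamma>_v by (fastforce simp: V0_carrier)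
    show "\<gamma> \<zero>\<^bsub>M\<^esub> = \<zero>\<^bsub>?N\<^esub>"
      using \<gamma>_v[of "\<zero>\<^bsub>R\<^esub>"] by (simp add: v_zero V0_semiring_def)
    show "\<gamma> \<one>\<^bsub>M\<^esub> = \<one>\<^bsub>?N\<^esub>"
      using \<gamma>_v[of "\<one>\<^bsub>R\<^esub>"] by (simp add: v_one V0_semiring_def)
  next
    fix a b assume "a \<in> carrier M" "b \<in> carrier M"
    then obtain x y where xy: "x \<in> carrier R" "y \<in> carrier R" "a = v x" "b = v y"
      using rep[of a] rep[of b] by auto
    then show "\<gamma> (a \<otimes>\<^bsub>M\<^esub> b) = \<gamma> a \<otimes>\<^bsub>?N\<^esub> \<gamma> b"
      using \<gamma>_v[of "x \<otimes>\<^bsub>R\<^esub> y"] by (simp add: \<gamma>_v v_mult R.V0_mult_class)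
    show "\<gamma> a \<preceq>\<^bsub>?N\<^esub> \<gamma> b" if "a \<preceq>\<^bsub>M\<^esub> b"
      using that xy V0_valuation_mono by (simp add: \<gamma>_v)
  qed unfold_locales
  moreover have "\<gamma> \<in> extensional (carrier M)"
    by (simp add: \<gamma>_def)
  ultimately show ?thesis
    using \<gamma>_v by auto
qed

end

theorem theorem1p12:
  fixes R :: "('a, 'm) ring_scheme"
    and M :: "('b, 'n) ordered_ring_rec_scheme"
    and v :: "'a \<Rightarrow> 'b"
    and \<pp> :: "'a set"
    and N :: "'a set ordered_ring_rec"
    and w :: "'a \<Rightarrow> 'a set"
  assumes "comm_semiring R"
    and "bipotent_semiring M"
    and "carrier M \<noteq> {\<zero>\<^bsub>M\<^esub>}"
    and "m_valuation R M v"
    and "v ` carrier R = carrier M"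
    and "\<pp> = valuation_prime R M v"
    and "N = V0_semiring R \<pp>"
    and "w = V0_valuation R \<pp>"
  shows "semiring_prime R \<pp>
    \<and> (\<exists>!\<gamma>. \<gamma> \<in> semiring_hom M N \<and> \<gamma> \<in> extensional (carrier M)
              \<and> (\<forall>x\<in>carrier R. w x = \<gamma> (v x)))
    \<and> (\<forall>\<gamma>\<in>semiring_hom M N. (\<forall>x\<in>carrier R. w x = \<gamma> (v x)) \<longrightarrow> \<gamma> ` carrier M = carrier N)"
proof -
  interpret bipotent_valuation R M v
    using assms by (simp add: bipotent_valuation_def bipotent_valuation_axioms_def)
  have prime: "semiring_prime R \<pp>"
    using assms semiring_prime_valuation_prime by simp
  obtain \<gamma> where \<gamma>: "\<gamma> \<in> semiring_hom M N" "\<gamma> \<in> extensional (carrier M)"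
      "\<forall>x\<in>carrier R. w x = \<gamma> (v x)"
    using ex_dominating_hom assms by blast
  \<comment> \<open>As \<open>v\<close> is onto, the factorisation fixes every value on
    \<open>carrier M\<close>; off the carrier both maps are \<open>undefined\<close>.\<close>
  have unique: "\<delta> = \<gamma>" if "\<delta> \<in> extensional (carrier M)" "\<forall>x\<in>carrier R. w x = \<delta> (v x)" for \<delta>
  proof (rule extensionalityI[OF that(1) \<gamma>(2)])
    fix a assume "a \<in> carrier M"
    then obtain x where "x \<in> carrier R" "a = v x"
      using assms(5) by blast
    then show "\<delta> a = \<gamma> a"
      using that(2) \<gamma>(3) by metis
  qed
  \<comment> \<open>\<delta>(M) = \<delta>(v(R)) = w(R), and w(R) is the set of all classes.\<close>
  have surj: "\<delta> ` carrier M = carrier N" if "\<forall>x\<in>carrier R. w x = \<delta> (v x)" for \<delta>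
  proof -
    have "\<delta> ` carrier M = w ` carrier R"
      unfolding assms(5)[symmetric] image_image using that by simp
    then show ?thesis
      using assms by (simp add: V0_carrier)
  qed
  have "\<exists>!\<gamma>. \<gamma> \<in> semiring_hom M N \<and> \<gamma> \<in> extensional (carrier M)
      \<and> (\<forall>x\<in>carrier R. w x = \<gamma> (v x))"
  proof (rule ex1I)
    show "\<gamma> \<in> semiring_hom M N \<and> \<gamma> \<in> extensional (carrier M) \<and> (\<forall>x\<in>carrier R. w x = \<gamma> (v x))"
      using \<gamma> by (intro conjI)
  qed (elim conjE, rule unique)
  moreover have "\<forall>\<delta>\<in>semiring_hom M N. (\<forall>x\<in>carrier R. w x = \<delta> (v x)) \<longrightarrow> \<delta> ` carrier M = carrier N"
    by (intro ballI impI, rule surj)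
  ultimately show ?thesis
    using prime by (intro conjI)
qed

end
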